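(* Let $n\ge1$, $r\in[1:n]$, $M\in[1:2^n]$, and $\alpha=M/2^n$. Then $\overline\Lambda_n(\alpha,r)\ge\psi_n^+(\alpha,r)$.
   Context: $[a:b]$ is the set of integers in $[a,b]$; $[x]^+=\max\{x,0\}$. Krawtchouk polynomials: $K_k(x)=\sum_{j=0}^k(-1)^j\binom xj\binom{n-x}{k-j}$ (generalized binomial coefficients, $\binom xj=0$ for $j<0$). Let $\omega_i=\sum_{k=0}^rK_k(i)$. $\overline\Lambda_n(\alpha,r)$ is the optimal value of the linear program: maximize $-\sum_{k=1}^n[K_k(0)+K_k(1)(\frac1\alpha-1)]x_k$ over $x_1,\dots,x_n\ge0$ subject to $\sum_{k=1}^n[K_k(1)-K_k(i)]x_k\ge-(\omega_1-\omega_i)$ for all $i\in[2:n]$. Let $\tau(n)=\frac12(\frac n2+2-\sqrt{\frac n2+2})$ and $F=\{\text{even }k:k\ge\frac{n+r+1}2\}\cup\{\text{odd }k:k\ge\max\{\frac{n+1}2,\frac{(n-1)r}{n-1-r}\}+\sqrt{\frac{(n+1)r}{2(n-1-r)}}\}$. $\psi_n^+=[\psi_n]^+$ with $\psi_n(\alpha,r)=\max_{\text{odd }k\in[n-\tau(n):n]}\frac{n\binom{n-2}{r-1}}{2k-n}[2(\frac1\alpha-1)-\frac1\alpha\frac{n+1}{k+1}]$ for even $r\le n/2-1$; $\psi_n(\alpha,r)=\max_{k\in[n-\tau(n):n]\cap F}\frac{(n-1)\binom{n-2}{r-1}}{2k-n-1}[2(\frac1\alpha-1)-\frac1\alpha\frac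 nk]$ for odd $r\le n/2-1$; $\psi_n(\alpha,r)=\max_{\text{odd }k\in[\frac n2+1:n]}\frac{k\binom{n-2}{r+1}}{2k-n}[2(\frac1\alpha-1)-\frac1\alpha\frac nk]$ for even $r>n/2-1$; $\psi_n(\alpha,r)=\max_{\text{odd }k\in[\frac n2+1:n]}\frac{k\binom{n-2}{r}}{2k-n}[2(\frac1\alpha-1)-\frac1\alpha\frac nk]$ for odd $r>n/2-1$. *)

theory Defs
  imports "HOL-Library.Extended_Real"
begin

definition krawtchouk :: "nat \<Rightarrow> nat \<Rightarrow> real \<Rightarrow> real" where
  "krawtchouk n k x =
     (\<Sum>j=0..k. (-1) ^ j * (x gchoose j) * ((real n - x) gchoose (k - j)))"

definition omega :: "nat \<Rightarrow> nat \<Rightarrow> nat \<Rightarrow> real" where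
  "omega n r i = (\<Sum>k=0..r. krawtchouk n k (real i))"

(* Only the values x k with k in {1..n} matter: they are the n variables of the program. *)
definition lp_feasible :: "nat \<Rightarrow> nat \<Rightarrow> (nat \<Rightarrow> real) \<Rightarrow> bool" where
  "lp_feasible n r x \<longleftrightarrow>
     (\<forall>k\<in>{1..n}. 0 \<le> x k) \<and>
     (\<forall>i\<in>{2..n}. (\<Sum>k=1..n. (krawtchouk n k 1 - krawtchouk n k (real i)) * x k)
                    \<ge> - (omega n r 1 - omega n r i))"

definition lp_objective :: "nat \<Rightarrow> real \<Rightarrow> (nat \<Rightarrow> real) \<Rightarrow> real" where
  "lp_objective n \<alpha> x =
     - (\<Sum>k=1..n. (krawtchouk n k 0 + krawtchouk n k 1 * (1 / \<alpha> - 1)) * x k)"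

(* The optimal value of a maximization problem, as a supremum in the extended reals, so that
   no convention for infeasible or unbounded programs is built in. *)
definition Lambda_bar :: "nat \<Rightarrow> real \<Rightarrow> nat \<Rightarrow> ereal" where
  "Lambda_bar n \<alpha> r = (SUP x\<in>{x. lp_feasible n r x}. ereal (lp_objective n \<alpha> x))"

definition int_range :: "real \<Rightarrow> real \<Rightarrow> int set" where
  "int_range a b = {k. a \<le> of_int k \<and> of_int k \<le> b}"

definition tau :: "nat \<Rightarrow> real" where
  "tau n = 1 / 2 * (real n / 2 + 2 - sqrt (real n / 2 + 2))"

definition F_set :: "nat \<Rightarrow> nat \<Rightarrow> int set" where
  "F_set n r =
     {k. even k \<and> of_int k \<ge> (real n + real r + 1) / 2} \<union>
     {k. odd k \<and> of_int k \<ge>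
          max ((real n + 1) / 2) ((real n - 1) * real r / (real n - 1 - real r))
          + sqrt ((real n + 1) * real r / (2 * (real n - 1 - real r)))}"

(* All index sets are finite, so each supremum is a maximum; over an empty index set it
   is -\<infinity>, whose positive part is 0. For r \<ge> 1 the denominators 2k - n, 2k - n - 1 and
   n - 1 - r are positive wherever they are used. *)
definition psi :: "nat \<Rightarrow> real \<Rightarrow> nat \<Rightarrow> ereal" where
  "psi n \<alpha> r =
     (if real r \<le> real n / 2 - 1 then
        if even r then
          (SUP k\<in>{k \<in> int_range (real n - tau n) (real n). odd k}.
             ereal (real n * ((real n - 2) gchoose (r - 1)) / (2 * of_int k - real n)
                    * (2 * (1 / \<alpha> - 1) - 1 / \<alpha> * ((real n + 1) / (of_int k + 1)))))
        else
          (SUP k\<in>int_range (real n - tau n) (real n) \<inter> F_set n r.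
             ereal ((real n - 1) * ((real n - 2) gchoose (r - 1)) / (2 * of_int k - real n - 1)
                    * (2 * (1 / \<alpha> - 1) - 1 / \<alpha> * (real n / of_int k))))
      else
        if even r then
          (SUP k\<in>{k \<in> int_range (real n / 2 + 1) (real n). odd k}.
             ereal (of_int k * ((real n - 2) gchoose (r + 1)) / (2 * of_int k - real n)
                    * (2 * (1 / \<alpha> - 1) - 1 / \<alpha> * (real n / of_int k))))
        else
          (SUP k\<in>{k \<in> int_range (real n / 2 + 1) (real n). odd k}.
             ereal (of_int k * ((real n - 2) gchoose r) / (2 * of_int k - real n)
                    * (2 * (1 / \<alpha> - 1) - 1 / \<alpha> * (real n / of_int k)))))"

definition psi_plus :: "nat \<Rightarrow> real \<Rightarrow> nat \<Rightarrow> ereal" where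
  "psi_plus n \<alpha> r = max (psi n \<alpha> r) 0"

end

theory Submission
  imports Defs "HOL-Computational_Algebra.Polynomial"
begin

text \<open>
  The value K_k(i) is the coefficient of x^k in (1 - x)^i (1 + x)^(n - i), and for i \<ge> 1 the sum
  omega_i is the coefficient of x^r in (1 - x)^(i - 1) (1 + x)^(n - i). Each term of psi is the
  objective value of an explicit feasible point: a multiple of the unit vector at k, except for
  even r \<le> n/2 - 1, where x_k = x_(k+1) (this merges K_k + K_(k+1) into a Krawtchouk polynomial of
  length n + 1). For r \<le> n/2 - 1 the multiple makes the constraint i = 2 tight.

  Feasibility rests on two extremal inequalities: |K_u(i)| \<le> |K_u(1)| for 1 \<le> i \<le> n - 1 and
  2u \<noteq> n, and |K_u(i)| \<le> K_u(2) for 2 \<le> i \<le> n - 2 and u \<le> tau(n). The first follows by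
  induction on n after splitting off a factor 1 - x^2 from the generating function, the second from
  the first after splitting off (1 - x^2)^2. The constraints i = n - 1 and i = n are settled by the
  symmetry i \<mapsto> n - i; they are the origin of the set F.
\<close>

section \<open>Coefficients of (1 - x)^a (1 + x)^b\<close>

text \<open>Integer indices make the recurrences hold without side conditions; the binomial
  coefficients are the case a = 0.\<close>

definition kcoeff :: "nat \<Rightarrow> nat \<Rightarrow> int \<Rightarrow> real" where
  "kcoeff a b u = (if u < 0 then 0 else coeff ([:1, -1:] ^ a * [:1, 1:] ^ b) (nat u))"

lemma coeff_linear_mult:
  fixes p :: "real poly"
  shows "coeff ([:1, c:] * p) j = coeff p j + c * (if j = 0 then 0 else coeff p (j - 1))"
  by (cases j) (simp_all add: coeff_pCons)

lemma kcoeff_Suc_left: "kcoeff (Suc a) b u = kcoeff a b u - kcoeff a b (u - 1)"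
proof -
  have "[:1, -1:] ^ Suc a * [:1, 1:] ^ b = [:1, -1:] * ([:1, -1:] ^ a * [:1, 1:] ^ b :: real poly)"
    by (simp only: power_Suc mult.assoc)
  then show ?thesis
    unfolding kcoeff_def by (simp only: coeff_linear_mult) (auto simp: nat_diff_distrib)
qed

lemma kcoeff_Suc_right: "kcoeff a (Suc b) u = kcoeff a b u + kcoeff a b (u - 1)"
proof -
  have "[:1, -1:] ^ a * [:1, 1:] ^ Suc b = [:1, 1:] * ([:1, -1:] ^ a * [:1, 1:] ^ b :: real poly)"
    by (simp only: power_Suc mult.left_commute)
  then show ?thesis
    unfolding kcoeff_def by (simp only: coeff_linear_mult) (auto simp: nat_diff_distrib)
qed

text \<open>The two factors multiply to 1 - x^2; both extremal inequalities start from this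
  recurrence.\<close>

lemma kcoeff_Suc_Suc: "kcoeff (Suc a) (Suc b) u = kcoeff a b u - kcoeff a b (u - 2)"
  by (simp add: kcoeff_Suc_left kcoeff_Suc_right)

lemma kcoeff_0_0: "kcoeff 0 0 u = (if u = 0 then 1 else 0)"
  by (auto simp: kcoeff_def)

lemma kcoeff_neg: "u < 0 \<Longrightarrow> kcoeff a b u = 0"
  by (simp add: kcoeff_def)

lemma kcoeff_0_int: "kcoeff 0 b (int u) = real (b choose u)"
proof (induction b arbitrary: u)
  case 0
  then show ?case by (simp add: kcoeff_0_0)
next
  case (Suc b)
  then show ?case
  proof (cases u)
    case 0
    then show ?thesis using Suc[of 0] by (simp add: kcoeff_Suc_right kcoeff_neg)
  next
    case (Suc v)
    have "int u - 1 = int v" using Suc by simp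
    then show ?thesis using Suc.IH[of u] Suc.IH[of v] Suc by (simp add: kcoeff_Suc_right)
  qed
qed

lemma kcoeff_0_nonneg: "kcoeff 0 b u \<ge> 0"
  by (cases u) (simp_all add: kcoeff_0_int kcoeff_neg)

lemma kcoeff_0_pos: "0 \<le> u \<Longrightarrow> u \<le> int b \<Longrightarrow> kcoeff 0 b u > 0"
  by (cases u) (simp_all add: kcoeff_0_int)

text \<open>Reversing the coefficients turns 1 - x into x - 1 and fixes 1 + x. This carries bounds
  from below the middle index to above it.\<close>

lemma kcoeff_reflect: "kcoeff a b (int a + int b - u) = (-1) ^ a * kcoeff a b u"
proof (induction a arbitrary: u)
  case 0
  show ?case
  proof (induction b arbitrary: u)
    case 0
    show ?case by (simp add: kcoeff_0_0)
  next
    case (Suc b)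
    show ?case
      using Suc.IH[of u] Suc.IH[of "u - 1"] by (simp add: kcoeff_Suc_right algebra_simps)
  qed
next
  case (Suc a)
  show ?case
    using Suc.IH[of u] Suc.IH[of "u - 1"] by (simp add: kcoeff_Suc_left algebra_simps)
qed

text \<open>The substitution of -x for x exchanges the two factors; in terms of K_u(i) it replaces i
  by n - i.\<close>

lemma kcoeff_swap: "kcoeff b a u = (if even u then 1 else -1) * kcoeff a b u"
proof (induction a arbitrary: b u)
  case 0
  show ?case
  proof (induction b arbitrary: u)
    case 0
    show ?case by (simp add: kcoeff_0_0)
  next
    case (Suc b)
    show ?case
      using Suc.IH[of u] Suc.IH[of "u - 1"] by (simp add: kcoeff_Suc_right kcoeff_Suc_left)
  qed
next
  case (Suc a)
  show ?case
    using Suc.IH[of b u] Suc.IH[of b "u - 1"] by (simp add: kcoeff_Suc_left kcoeff_Suc_right)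
qed

lemma kcoeff_gt: "u > int a + int b \<Longrightarrow> kcoeff a b u = 0"
  using kcoeff_reflect[of a b u] by (simp add: kcoeff_neg)

lemma abs_kcoeff_reflect: "\<bar>kcoeff a b (int a + int b - u)\<bar> = \<bar>kcoeff a b u\<bar>"
  by (simp add: kcoeff_reflect abs_mult power_abs)

lemma kcoeff_absorb: "(of_int u + 1) * kcoeff 0 b (u + 1) = (real b - of_int u) * kcoeff 0 b u"
proof (induction b arbitrary: u)
  case 0
  show ?case by (auto simp: kcoeff_0_0)
next
  case (Suc b)
  show ?case
    using Suc.IH[of u] Suc.IH[of "u - 1"] by (simp add: kcoeff_Suc_right algebra_simps)
qed

lemma kcoeff_absorb_pred: "of_int u * kcoeff 0 b u = (real b + 1 - of_int u) * kcoeff 0 b (u - 1)"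
  using kcoeff_absorb[of "u - 1" b] by simp

lemma kcoeff_absorb_Suc: "of_int u * kcoeff 0 (Suc b) u = (real b + 1) * kcoeff 0 b (u - 1)"
  using kcoeff_absorb_pred[of u b] by (simp add: kcoeff_Suc_right algebra_simps)

lemma kcoeff_absorb_Suc': "(real b + 1 - of_int u) * kcoeff 0 (Suc b) u = (real b + 1) * kcoeff 0 b u"
  using kcoeff_absorb_pred[of u b] by (simp add: kcoeff_Suc_right algebra_simps)

text \<open>The closed form of K_u(1) with n = b + 1, that is (1 - 2u/n) times the binomial
  coefficient. It shows the sign of K_u(1) and its zero at the middle.\<close>

lemma kcoeff_1: "(real b + 1) * kcoeff (Suc 0) b u = (real b + 1 - 2 * of_int u) * kcoeff 0 (Suc b) u"
  using kcoeff_absorb_Suc[of u b] kcoeff_absorb_Suc'[of b u]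
  by (simp add: kcoeff_Suc_left kcoeff_Suc_right algebra_simps)

text \<open>For v \<ge> 1 consecutive binomial coefficients have ratio (b + 1 - v) / v, which the
  first assumption bounds below by \<open>c\<close>.\<close>

lemma kcoeff_0_mono:
  assumes "c * of_int v \<le> real b + 1 - of_int v" and "c \<ge> 0"
  shows "c * kcoeff 0 b (v - 1) \<le> kcoeff 0 b v"
proof (cases "v \<ge> 1")
  case True
  have "of_int v * (c * kcoeff 0 b (v - 1)) \<le> (real b + 1 - of_int v) * kcoeff 0 b (v - 1)"
    using mult_right_mono[OF assms(1) kcoeff_0_nonneg[of b "v - 1"]] by (simp add: ac_simps)
  then have "of_int v * (c * kcoeff 0 b (v - 1)) \<le> of_int v * kcoeff 0 b v"
    by (simp add: kcoeff_absorb_pred)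
  then show ?thesis using True by simp
next
  case False
  then show ?thesis by (simp add: kcoeff_neg kcoeff_0_nonneg)
qed

lemma kcoeff_0_mono_1: "2 * v \<le> int b + 1 \<Longrightarrow> kcoeff 0 b (v - 1) \<le> kcoeff 0 b v"
  using kcoeff_0_mono[of 1 v b] by linarith

lemma kcoeff_0_mono_2: "3 * v \<le> int b + 1 \<Longrightarrow> 2 * kcoeff 0 b (v - 1) \<le> kcoeff 0 b v"
  using kcoeff_0_mono[of 2 v b] by linarith

lemma kcoeff_at_0: "kcoeff a b 0 = 1"
proof (induction a)
  case 0
  show ?case using kcoeff_0_int[of b 0] by simp
next
  case (Suc a)
  then show ?case by (simp add: kcoeff_Suc_left kcoeff_neg)
qed

lemma kcoeff_at_1: "kcoeff a b 1 = real b - real a"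
proof (induction a)
  case 0
  show ?case using kcoeff_0_int[of b 1] by simp
next
  case (Suc a)
  then show ?case by (simp add: kcoeff_Suc_left kcoeff_at_0)
qed

section \<open>Krawtchouk values and their partial sums as coefficients\<close>

lemma krawtchouk_eq_kcoeff:
  assumes "i \<le> n" shows "krawtchouk n k (real i) = kcoeff i (n - i) (int k)"
proof -
  \<comment> \<open>The binomial expansion, with both sides 0 for \<open>j > m\<close>; the Cauchy
    product of two such expansions is the defining sum of K_k(i).\<close>
  have 1: "coeff ([:1, c:] ^ m) j = real (m choose j) * c ^ j" for c :: real and m j
  proof (cases "j \<le> m")
    case False
    have "degree ([:1, c:] ^ m) \<le> degree [:1, c:] * m" by (rule degree_power_le)
    also have "\<dots> < j" using False by auto
    finally show ?thesis using False by (simp add: coeff_eq_0)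
  qed (simp add: coeff_linear_poly_power)
  have "krawtchouk n k (real i) = (\<Sum>j\<le>k. (-1) ^ j * real (i choose j) * real (n - i choose (k - j)))"
    using assms unfolding krawtchouk_def atMost_atLeast0
    by (simp add: binomial_gbinomial of_nat_diff)
  then show ?thesis
    by (simp add: kcoeff_def coeff_mult 1 mult.commute)
qed

text \<open>Splitting off one factor 1 - x makes each summand a difference of consecutive
  coefficients, and the sum telescopes.\<close>

lemma omega_eq_kcoeff:
  assumes "i < n" shows "omega n r (Suc i) = kcoeff i (n - Suc i) (int r)"
proof -
  have "omega n r (Suc i) = (\<Sum>k=0..r. kcoeff (Suc i) (n - Suc i) (int k))"
    using assms unfolding omega_def by (intro sum.cong krawtchouk_eq_kcoeff) auto
  also have "\<dots> = kcoeff i (n - Suc i) (int r)"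
    by (induction r) (simp_all add: kcoeff_Suc_left kcoeff_neg)
  finally show ?thesis .
qed

section \<open>The extremal inequalities\<close>

lemma kcoeff_1_nonneg: "2 * u \<le> int b + 1 \<Longrightarrow> kcoeff (Suc 0) b u \<ge> 0"
  using kcoeff_0_mono_1[of u b] by (simp add: kcoeff_Suc_left)

lemma kcoeff_1_middle:
  assumes "2 * u = int b + 1" shows "kcoeff (Suc 0) b u = 0"
proof -
  have "real b + 1 - 2 * of_int u = 0" using assms by linarith
  then show ?thesis using kcoeff_1[of b u] by simp
qed

lemma abs_kcoeff_swap: "\<bar>kcoeff b a u\<bar> = \<bar>kcoeff a b u\<bar>"
  by (subst kcoeff_swap) simp

text \<open>The induction removes a factor 1 - x^2, and can step from 2u < n to the central index of
  length n - 2, where K_u(1) = 0; hence the separate bound |K_u(2)| for that index.\<close>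

lemma abs_kcoeff_le_aux:
  "(2 * u < int a + int b + 2 \<longrightarrow>
      \<bar>kcoeff (Suc a) (Suc b) u\<bar> \<le> kcoeff (Suc 0) (Suc (a + b)) u) \<and>
   (2 * u = int a + int b + 2 \<longrightarrow>
      (real a + real b + 1) * \<bar>kcoeff (Suc a) (Suc b) u\<bar> \<le> kcoeff 0 (Suc (Suc (a + b))) u)"
proof (induction a arbitrary: b u)
  case 0
  have "kcoeff (Suc 0) (Suc b) u = 0" if "2 * u = int b + 2"
    using kcoeff_1_middle[of u "Suc b"] that by simp
  then show ?case
    using kcoeff_1_nonneg[of u "Suc b"] by (auto simp: kcoeff_0_nonneg)
next
  case (Suc a)
  show ?case
  proof (cases b)
    case 0
    \<comment> \<open>With a single factor 1 + x the coefficient is, up to sign, the extremal value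
      itself.\<close>
    have "kcoeff (Suc 0) (Suc (Suc a)) u = 0" if "2 * u = int a + 3"
      using kcoeff_1_middle[of u "Suc (Suc a)"] that by simp
    then show ?thesis
      using kcoeff_1_nonneg[of u "Suc (Suc a)"] 0
      by (auto simp: kcoeff_0_nonneg abs_kcoeff_swap[of "Suc (Suc a)"])
  next
    case (Suc b')
    \<comment> \<open>With n = a + b + 3, \<open>X\<close> has the length n - 2 left after splitting
      off 1 - x^2. The binomial coefficients \<open>c\<close> of length n - 3 express the extremal
      value of length n - 2 at v as \<open>c v - c (v - 1)\<close>.\<close>
    define X where "X v = kcoeff (Suc a) (Suc b') v" for v
    define c where "c v = kcoeff 0 (Suc (a + b')) v" for v
    have goal_eq: "kcoeff (Suc (Suc a)) (Suc b) u = X u - X (u - 2)"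
      using Suc by (simp add: X_def kcoeff_Suc_Suc[of "Suc a"])
    have IH1: "\<bar>X v\<bar> \<le> c v - c (v - 1)" if "2 * v < int a + int b' + 2" for v
      using Suc.IH[of v b'] that by (simp add: X_def c_def kcoeff_Suc_left)
    have IH2: "(real a + real b' + 1) * \<bar>X v\<bar> \<le> c v + c (v - 1)" if "2 * v = int a + int b' + 2" for v
      using Suc.IH[of v b'] that by (simp add: X_def c_def kcoeff_Suc_right)
    have reflX: "\<bar>X v\<bar> = \<bar>X w\<bar>" if "v + w = int a + int b' + 2" for v w
    proof -
      have "w = int (Suc a) + int (Suc b') - v" using that by simp
      then show ?thesis unfolding X_def by (simp only: abs_kcoeff_reflect)
    qed
    have reflc: "c v = c w" if "v + w = int a + int b' + 1" for v w
    proof -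
      have "w = int 0 + int (Suc (a + b')) - v" using that by simp
      then show ?thesis unfolding c_def by (simp only: kcoeff_reflect) simp
    qed
    have abs_c: "of_int v * c v = (real a + real b' + 2 - of_int v) * c (v - 1)" for v
      using kcoeff_absorb_pred[of v "Suc (a + b')"] by (simp add: c_def algebra_simps)
    have c0: "c v \<ge> 0" for v by (simp add: c_def kcoeff_0_nonneg)
    have tgt1: "kcoeff (Suc 0) (Suc (Suc a + b)) u = c u + c (u - 1) - c (u - 2) - c (u - 3)"
      using Suc by (simp add: c_def kcoeff_Suc_left kcoeff_Suc_right)
    have tgt2: "kcoeff 0 (Suc (Suc (Suc a + b))) u = c u + 3 * c (u - 1) + 3 * c (u - 2) + c (u - 3)"
      using Suc by (simp add: c_def kcoeff_Suc_right)
    have tri: "\<bar>X u - X (u - 2)\<bar> \<le> \<bar>X u\<bar> + \<bar>X (u - 2)\<bar>" by simp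
    show ?thesis
    proof (intro conjI impI)
      assume "2 * u < int (Suc a) + int b + 2"
      then have u: "2 * u < int a + int b' + 4" using Suc by simp
      have X2: "\<bar>X (u - 2)\<bar> \<le> c (u - 2) - c (u - 3)" using IH1[of "u - 2"] u by simp
      \<comment> \<open>Relative to length n - 2, the index u lies below the middle, at it, or one
        half beyond it.\<close>
      consider "2 * u < int a + int b' + 2" | "2 * u = int a + int b' + 2" | "2 * u = int a + int b' + 3"
        using u by linarith
      then have "\<bar>X u - X (u - 2)\<bar> \<le> c u + c (u - 1) - c (u - 2) - c (u - 3)"
      proof cases
        case 1
        have "c (u - 2) \<le> c (u - 1)"
          using kcoeff_0_mono_1[of "u - 1" "Suc (a + b')"] 1 by (simp add: c_def)
        then show ?thesis using IH1[OF 1] X2 tri by linarith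
      next
        case 2
        have u1: "u \<ge> 1" using 2 by linarith
        have ab: "real a + real b' = 2 * of_int u - 2" using 2 by linarith
        have cu: "c u = c (u - 1)" using 2 by (intro reflc) simp
        \<comment> \<open>By symmetry the goal reduces to
          \<open>\<bar>X u\<bar> \<le> 2 * (c (u - 1) - c (u - 2))\<close>; this identity brings the
          central bound into that form.\<close>
        have e1: "(of_int u + 1) * (c (u - 1) - c (u - 2)) = 2 * c (u - 1)"
          using abs_c[of "u - 1"] ab by (simp add: algebra_simps)
        have "(of_int u + 1) * \<bar>X u\<bar> \<le> (2 * (2 * of_int u - 1)) * \<bar>X u\<bar>"
          using u1 by (intro mult_right_mono) auto
        also have "\<dots> \<le> 4 * c (u - 1)"
          using IH2[OF 2] ab cu by (simp add: algebra_simps)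
        also have "\<dots> = (of_int u + 1) * (2 * (c (u - 1) - c (u - 2)))"
          using e1 by (simp add: algebra_simps)
        finally have "\<bar>X u\<bar> \<le> 2 * (c (u - 1) - c (u - 2))" using u1 by simp
        from order_trans[OF tri add_mono[OF this X2]] show ?thesis by (simp add: cu)
      next
        case 3
        \<comment> \<open>Reflection in length n - 2 sends u to u - 1, back below the
          middle.\<close>
        have "\<bar>X u\<bar> = \<bar>X (u - 1)\<bar>" using 3 by (intro reflX) simp
        also have "\<dots> \<le> c (u - 1) - c (u - 2)" using IH1[of "u - 1"] 3 by simp
        finally have "\<bar>X u\<bar> \<le> c (u - 1) - c (u - 2)" .
        moreover have "c (u - 2) = c u" using 3 by (intro reflc) simp
        ultimately show ?thesis using X2 tri by linarith
      qed
      then show "\<bar>kcoeff (Suc (Suc a)) (Suc b) u\<bar> \<le> kcoeff (Suc 0) (Suc (Suc a + b)) u"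
        by (simp only: goal_eq tgt1)
    next
      assume "2 * u = int (Suc a) + int b + 2"
      then have u: "2 * u = int a + int b' + 4" using Suc by simp
      have ab: "real a + real b' = 2 * of_int u - 4" using u by linarith
      have X2: "\<bar>X (u - 2)\<bar> \<le> c (u - 2) - c (u - 3)" using IH1[of "u - 2"] u by simp
      \<comment> \<open>Here 2u = n, so reflection in length n - 2 sends u to u - 2 and one bound
        serves both terms.\<close>
      have "\<bar>X u\<bar> = \<bar>X (u - 2)\<bar>" using u by (intro reflX) simp
      then have "\<bar>X u\<bar> \<le> c (u - 2) - c (u - 3)" using X2 by (simp only:)
      from order_trans[OF tri add_mono[OF this X2]]
      have le: "\<bar>X u - X (u - 2)\<bar> \<le> 2 * (c (u - 2) - c (u - 3))" by simp
      have c3: "c u = c (u - 3)" using u by (intro reflc) simp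
      have c2: "c (u - 1) = c (u - 2)" using u by (intro reflc) simp
      have e: "of_int u * (c (u - 2) - c (u - 3)) = 2 * c (u - 2)"
        using abs_c[of "u - 2"] ab by (simp add: algebra_simps)
      have "real (Suc a) + real b + 1 = 2 * of_int u - 1" using u Suc by linarith
      moreover have "(2 * of_int u - 1) * \<bar>X u - X (u - 2)\<bar>
          \<le> (2 * of_int u - 1) * (2 * (c (u - 2) - c (u - 3)))"
        using le u by (intro mult_left_mono) auto
      moreover have "\<dots> = c u + 3 * c (u - 1) + 3 * c (u - 2) + c (u - 3)"
        using e c2 c3 by (simp add: algebra_simps)
      ultimately show "(real (Suc a) + real b + 1) * \<bar>kcoeff (Suc (Suc a)) (Suc b) u\<bar>
          \<le> kcoeff 0 (Suc (Suc (Suc a + b))) u"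
        by (simp only: goal_eq tgt2)
    qed
  qed
qed

lemma abs_kcoeff_le:
  assumes "1 \<le> a" "1 \<le> b" "2 * u < int a + int b"
  shows "\<bar>kcoeff a b u\<bar> \<le> kcoeff 1 (a + b - 1) u"
  using abs_kcoeff_le_aux[of u "a - 1" "b - 1"] assms by (cases a; cases b) (simp_all add: ac_simps)

lemma abs_kcoeff_middle_le:
  assumes "1 \<le> a" "1 \<le> b" "2 * u = int a + int b"
  shows "(real a + real b - 1) * \<bar>kcoeff a b u\<bar> \<le> kcoeff 0 (a + b) u"
  using abs_kcoeff_le_aux[of u "a - 1" "b - 1"] assms by (cases a; cases b) (simp_all add: ac_simps)

text \<open>Reflection of \<open>abs_kcoeff_le\<close> in the middle; K_u(1) changes sign because
  its exponent of 1 - x is odd.\<close>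

lemma abs_kcoeff_le_upper:
  assumes "1 \<le> a" "1 \<le> b" "2 * u > int a + int b"
  shows "\<bar>kcoeff a b u\<bar> \<le> - kcoeff 1 (a + b - 1) u"
  using abs_kcoeff_le[of a b "int a + int b - u"] abs_kcoeff_reflect[of a b u]
    kcoeff_reflect[of 1 "a + b - 1" u] assms by (simp add: of_nat_diff)

text \<open>At n = 2r + 1 with r odd, neither side of a constraint with odd i can be bounded
  separately by its extremal value; the gain 1 - 2/(n - 2) here makes up for it.\<close>

lemma abs_kcoeff_le_strict:
  assumes "2 \<le> a" "2 \<le> b" "1 \<le> u" "2 * u < int a + int b - 2"
  shows "(real a + real b - 2) * \<bar>kcoeff a b u\<bar> \<le> (real a + real b - 4) * kcoeff 1 (a + b - 1) u"
proof -
  obtain a' b' where ab: "a = Suc (Suc a')" "b = Suc (Suc b')"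
    using assms by (metis Suc_le_D numeral_2_eq_2 Suc_le_mono)
  define N where "N = real a' + real b' + 4"
  define c where "c v = kcoeff 0 (Suc (a' + b')) v" for v
  have K: "kcoeff a b u = kcoeff (Suc a') (Suc b') u - kcoeff (Suc a') (Suc b') (u - 2)"
    by (simp add: ab kcoeff_Suc_Suc[of "Suc a'"])
  have bound: "\<bar>kcoeff (Suc a') (Suc b') v\<bar> \<le> c v - c (v - 1)" if "v \<le> u" for v
    using abs_kcoeff_le[of "Suc a'" "Suc b'" v] that assms
    by (simp add: ab c_def kcoeff_Suc_left)
  define k where "k = kcoeff 1 (a + b - 1) u"
  have k: "k = c u + c (u - 1) - c (u - 2) - c (u - 3)"
    by (simp add: k_def ab c_def kcoeff_Suc_left kcoeff_Suc_right)
  \<comment> \<open>Bounding the two terms separately already gains twice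
    \<open>c (u - 1) - c (u - 2)\<close>; the rest shows that this difference is at least k / (N -
    2).\<close>
  have le: "\<bar>kcoeff a b u\<bar> \<le> k - 2 * (c (u - 1) - c (u - 2))"
    using bound[of u] bound[of "u - 2"] unfolding K k by simp
  define e where "e = kcoeff 0 (Suc (Suc (a' + b'))) (u - 1)"
  define f where "f = kcoeff 0 (a + b) u"
  define U :: real where "U = of_int u"
  have U: "U \<ge> 1" "2 * U < N - 2" using assms by (simp_all add: U_def N_def ab)
  have e: "(N - 2) * (c (u - 1) - c (u - 2)) = (N - 2 * U) * e"
    using kcoeff_1[of "Suc (a' + b')" "u - 1"]
    by (simp add: c_def e_def N_def U_def kcoeff_Suc_left algebra_simps)
  have f: "N * k = (N - 2 * U) * f"
    using kcoeff_1[of "Suc (Suc (Suc (a' + b')))" u]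
    by (simp add: k_def f_def N_def U_def ab algebra_simps)
  define g where "g = kcoeff 0 (Suc (Suc (Suc (a' + b')))) (u - 1)"
  have g1: "U * f = N * g"
    using kcoeff_absorb_Suc[of u "Suc (Suc (Suc (a' + b')))"]
    by (simp add: f_def g_def N_def U_def ab algebra_simps)
  have g2: "(N - U) * g = (N - 1) * e"
    using kcoeff_absorb_Suc'[of "Suc (Suc (a' + b'))" "u - 1"]
    by (simp add: e_def g_def N_def U_def algebra_simps)
  have f0: "f \<ge> 0" by (simp add: f_def kcoeff_0_nonneg)
  \<comment> \<open>The product expands to U (N - U) - (N - 1). Since U (N - U) f = N (N - 1) e,
    this yields f \<le> N e.\<close>
  have "(U - 1) * (N - U - 1) \<ge> 0" using U by simp
  then have "(N - 1) * f \<le> (U * (N - U)) * f"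
    using f0 by (intro mult_right_mono) (auto simp: algebra_simps)
  also have "\<dots> = (N - 1) * (N * e)" using g1 g2 by (metis mult.assoc mult.commute)
  finally have "f \<le> N * e" using U by simp
  then have "N * k \<le> N * ((N - 2 * U) * e)"
    using U f by (simp add: mult.left_commute)
  then have "k \<le> (N - 2) * (c (u - 1) - c (u - 2))" using U e by simp
  moreover have "(N - 2) * \<bar>kcoeff a b u\<bar> \<le> (N - 2) * (k - 2 * (c (u - 1) - c (u - 2)))"
    using le U by (intro mult_left_mono) auto
  ultimately have "(N - 2) * \<bar>kcoeff a b u\<bar> \<le> (N - 4) * k"
    by (simp add: algebra_simps)
  then show ?thesis by (simp add: N_def ab k_def)
qed

text \<open>Splitting off (1 - x^2)^2 leaves three coefficients of length n - 4, where n = a + b,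
  each bounded by the first extremal inequality. The sum of the bounds stays below K_u(2) once 2 c(u
  - 2) \<le> c(u - 1) for the binomial coefficients c of length n - 5, and 3 u + 1 \<le> n is the
  condition \<open>kcoeff_0_mono_2\<close> asks for.\<close>

lemma abs_kcoeff_le_2:
  assumes "2 \<le> a" "2 \<le> b" and u: "3 * u + 1 \<le> int a + int b" "u \<le> 1 \<or> 2 * u + 4 < int a + int b"
  shows "\<bar>kcoeff a b u\<bar> \<le> kcoeff 2 (a + b - 2) u"
proof -
  have nonneg: "kcoeff 2 (a + b - 2) u \<ge> 0"
    using kcoeff_0_mono_2[of u "a + b - 2"] kcoeff_0_nonneg[of "a + b - 2" "u - 2"] assms
    by (simp add: numeral_2_eq_2 kcoeff_Suc_left of_nat_diff)
  show ?thesis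
  proof (cases "a = 2 \<or> b = 2")
    case True
    then show ?thesis using nonneg abs_kcoeff_swap[of a 2 u] by auto
  next
    case False
    define a' b' where "a' = a - 2" and "b' = b - 2"
    have ab: "a = Suc (Suc a')" "b = Suc (Suc b')" "1 \<le> a'" "1 \<le> b'"
      using assms(1,2) False by (auto simp: a'_def b'_def)
    obtain m where m: "a' + b' = Suc m" using ab by (cases "a' + b'") auto
    define c where "c v = kcoeff 0 m v" for v
    have K: "kcoeff a b u = kcoeff a' b' u - 2 * kcoeff a' b' (u - 2) + kcoeff a' b' (u - 4)"
      by (simp add: ab kcoeff_Suc_Suc)
    have bound: "\<bar>kcoeff a' b' v\<bar> \<le> c v - c (v - 1)" if "v \<le> u" for v
    proof (cases "2 * v < int a' + int b'")
      case True
      then show ?thesis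
        using abs_kcoeff_le[of a' b' v] ab m by (simp add: c_def kcoeff_Suc_left)
    next
      case False
      \<comment> \<open>Only the first-order coefficient can reach the middle of length n - 4, and
        it is explicit.\<close>
      then have "v = 1" using u that ab by auto
      then show ?thesis
        using kcoeff_at_1[of a' b'] kcoeff_at_1[of 1 m] m ab
        by (simp add: c_def kcoeff_Suc_left)
    qed
    have "2 * c (u - 2) \<le> c (u - 1)"
      using kcoeff_0_mono_2[of "u - 1" m] u ab m by (simp add: c_def)
    moreover have "kcoeff 2 (a + b - 2) u
        = c u + c (u - 1) - 2 * c (u - 2) - 2 * c (u - 3) + c (u - 4) + c (u - 5)"
    proof -
      have "a + b - 2 = Suc (Suc (Suc m))" using ab m by simp
      then show ?thesis by (simp add: c_def numeral_2_eq_2 kcoeff_Suc_left kcoeff_Suc_right)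
    qed
    moreover have "c (u - 5) \<ge> 0" by (simp add: c_def kcoeff_0_nonneg)
    ultimately show ?thesis
      using bound[of u] bound[of "u - 2"] bound[of "u - 4"] unfolding K by simp
  qed
qed

section \<open>Explicit points of the linear program\<close>

lemma Lambda_bar_ge_objective: "lp_feasible n r x \<Longrightarrow> ereal (lp_objective n \<alpha> x) \<le> Lambda_bar n \<alpha> r"
  unfolding Lambda_bar_def by (rule SUP_upper) simp

text \<open>Replacing 1 - x by 1 + x can only increase coefficients in absolute value. Hence the
  point 0 is feasible.\<close>

lemma abs_kcoeff_le_kcoeff_0: "\<bar>kcoeff a b u\<bar> \<le> kcoeff 0 (a + b) u"
proof (induction a arbitrary: u)
  case 0
  show ?case by (simp add: kcoeff_0_nonneg)
next
  case (Suc a)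
  show ?case
    using Suc.IH[of u] Suc.IH[of "u - 1"] by (simp add: kcoeff_Suc_left kcoeff_Suc_right)
qed

lemma omega_diff_eq:
  assumes "2 \<le> i" "i \<le> n"
  shows "omega n r 1 - omega n r i = kcoeff 0 (n - 1) (int r) - kcoeff (i - 1) (n - i) (int r)"
  using omega_eq_kcoeff[of 0 n r] omega_eq_kcoeff[of "i - 1" n r] assms by simp

text \<open>The constraints become upper bounds whose right-hand side is the slack at the point
  0.\<close>

lemma lp_feasible_iff_kcoeff:
  "lp_feasible n r x \<longleftrightarrow> (\<forall>k\<in>{1..n}. 0 \<le> x k) \<and>
     (\<forall>i\<in>{2..n}. (\<Sum>k=1..n. (kcoeff i (n - i) (int k) - kcoeff 1 (n - 1) (int k)) * x k)
        \<le> kcoeff 0 (n - 1) (int r) - kcoeff (i - 1) (n - i) (int r))"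
proof -
  have "(\<Sum>k=1..n. (krawtchouk n k 1 - krawtchouk n k (real i)) * x k) \<ge> - (omega n r 1 - omega n r i)
      \<longleftrightarrow> (\<Sum>k=1..n. (kcoeff i (n - i) (int k) - kcoeff 1 (n - 1) (int k)) * x k)
        \<le> kcoeff 0 (n - 1) (int r) - kcoeff (i - 1) (n - i) (int r)"
    if i: "i \<in> {2..n}" for i
  proof -
    have "(\<Sum>k=1..n. (krawtchouk n k 1 - krawtchouk n k (real i)) * x k)
        = - (\<Sum>k=1..n. (kcoeff i (n - i) (int k) - kcoeff 1 (n - 1) (int k)) * x k)"
      using i krawtchouk_eq_kcoeff[of 1 n] krawtchouk_eq_kcoeff[of i n]
      by (simp add: algebra_simps flip: sum_negf)
    moreover have "omega n r 1 - omega n r i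
        = kcoeff 0 (n - 1) (int r) - kcoeff (i - 1) (n - i) (int r)"
      using i by (intro omega_diff_eq) auto
    ultimately show ?thesis by linarith
  qed
  then show ?thesis
    unfolding lp_feasible_def by (intro arg_cong2[of _ _ _ _ conj] refl ball_cong)
qed

lemma lp_objective_eq_kcoeff:
  assumes "n \<ge> 1"
  shows "lp_objective n \<alpha> x = (\<Sum>k=1..n. ((2 * real k / real n - 1) * (1 / \<alpha> - 1) - 1) * kcoeff 0 n (int k) * x k)"
proof -
  have "krawtchouk n k 1 = (1 - 2 * real k / real n) * kcoeff 0 n (int k)" for k
  proof -
    have "real n * krawtchouk n k 1 = (real n - 2 * real k) * kcoeff 0 n (int k)"
      using krawtchouk_eq_kcoeff[of 1 n k] kcoeff_1[of "n - 1" "int k"] assms by (simp add: of_nat_diff)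
    then show ?thesis using assms by (simp add: field_simps)
  qed
  moreover have "krawtchouk n k 0 = kcoeff 0 n (int k)" for k
    using krawtchouk_eq_kcoeff[of 0 n k] by simp
  ultimately show ?thesis
    unfolding lp_objective_def sum_negf[symmetric]
    by (intro sum.cong) (simp_all only: minus_mult_left, simp add: algebra_simps)
qed

lemma Lambda_bar_nonneg: "Lambda_bar n \<alpha> r \<ge> 0"
proof -
  have "lp_feasible n r (\<lambda>_. 0)"
    unfolding lp_feasible_iff_kcoeff
  proof (intro conjI ballI)
    fix i assume "i \<in> {2..n}"
    then have "i - 1 + (n - i) = n - 1" by auto
    then show "(\<Sum>k=1..n. (kcoeff i (n - i) (int k) - kcoeff 1 (n - 1) (int k)) * 0)
        \<le> kcoeff 0 (n - 1) (int r) - kcoeff (i - 1) (n - i) (int r)"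
      using abs_kcoeff_le_kcoeff_0[of "i - 1" "n - i" "int r"] by (simp add: abs_le_iff)
  qed simp
  from Lambda_bar_ge_objective[OF this] show ?thesis
    by (simp add: lp_objective_def zero_ereal_def)
qed

text \<open>The point is \<open>t\<close> times the unit vector at \<open>k\<close>. Taking the
  factor k/n out of the objective produces the bracket that occurs in \<open>psi\<close>.\<close>

lemma Lambda_bar_ge_single:
  assumes "1 \<le> k" "k \<le> n" "t \<ge> 0"
    and "\<And>i. 2 \<le> i \<Longrightarrow> i \<le> n \<Longrightarrow> t * (kcoeff i (n - i) (int k) - kcoeff 1 (n - 1) (int k))
           \<le> kcoeff 0 (n - 1) (int r) - kcoeff (i - 1) (n - i) (int r)"
  shows "ereal (t * kcoeff 0 n (int k) * real k / real n * (2 * (1 / \<alpha> - 1) - 1 / \<alpha> * (real n / real k)))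
    \<le> Lambda_bar n \<alpha> r"
proof -
  let ?x = "\<lambda>j. if j = k then t else 0"
  have sum_eq: "(\<Sum>j=1..n. g j * ?x j) = t * g k" for g :: "nat \<Rightarrow> real"
    using assms(1,2) by (simp add: if_distrib[of "\<lambda>y. _ * y"] mult.commute cong: if_cong)
  have feasible: "lp_feasible n r ?x"
    unfolding lp_feasible_iff_kcoeff sum_eq using assms by auto
  have objective: "lp_objective n \<alpha> ?x
      = t * kcoeff 0 n (int k) * real k / real n * (2 * (1 / \<alpha> - 1) - 1 / \<alpha> * (real n / real k))"
  proof -
    have "(2 * real k / real n - 1) * (1 / \<alpha> - 1) - 1
        = real k / real n * (2 * (1 / \<alpha> - 1) - 1 / \<alpha> * (real n / real k))"
      using assms(1,2) by (simp add: right_diff_distrib left_diff_distrib diff_divide_distrib mult.commute)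
    moreover have "lp_objective n \<alpha> ?x
        = t * (((2 * real k / real n - 1) * (1 / \<alpha> - 1) - 1) * kcoeff 0 n (int k))"
      using assms(1,2) by (simp only: lp_objective_eq_kcoeff sum_eq)
    ultimately show ?thesis by simp
  qed
  show ?thesis using Lambda_bar_ge_objective[OF feasible, of \<alpha>] unfolding objective .
qed

text \<open>The point has the value \<open>t\<close> at k and k + 1. Adding the two Krawtchouk
  polynomials amounts to one more factor 1 + x, so the constraints involve coefficients of length n
  + 1 at index k + 1.\<close>

lemma Lambda_bar_ge_pair:
  assumes "1 \<le> k" "k \<le> n" "t \<ge> 0"
    and "\<And>i. 2 \<le> i \<Longrightarrow> i \<le> n \<Longrightarrow> t * (kcoeff i (Suc n - i) (int k + 1) - kcoeff 1 n (int k + 1))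
           \<le> kcoeff 0 (n - 1) (int r) - kcoeff (i - 1) (n - i) (int r)"
  shows "ereal (t * kcoeff 0 n (int k) * (2 * (1 / \<alpha> - 1) - 1 / \<alpha> * ((real n + 1) / (real k + 1))))
    \<le> Lambda_bar n \<alpha> r"
proof -
  let ?x = "\<lambda>j. (if j = k then t else 0) + (if j = Suc k then t else 0)"
  have sum_eq: "(\<Sum>j=1..n. g j * ?x j) = t * (g k + g (Suc k))"
    \<comment> \<open>For k = n the second entry lies outside the program; this is harmless because
      the coefficients at n + 1 vanish.\<close>
    if "k = n \<Longrightarrow> g (Suc k) = 0" for g :: "nat \<Rightarrow> real"
  proof -
    have "(\<Sum>j=1..n. g j * ?x j) = (\<Sum>j=1..n. if j = k then g j * t else 0) + (\<Sum>j=1..n. if j = Suc k then g j * t else 0)"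
      unfolding sum.distrib[symmetric] by (intro sum.cong) auto
    then show ?thesis
      using assms(1,2) that by (cases "k = n") (simp_all add: algebra_simps)
  qed
  have feasible: "lp_feasible n r ?x"
    unfolding lp_feasible_iff_kcoeff
  proof (intro conjI ballI)
    fix i assume i: "i \<in> {2..n}"
    then have "kcoeff i (Suc n - i) (int k + 1) - kcoeff 1 n (int k + 1) =
        kcoeff i (n - i) (int k) - kcoeff 1 (n - 1) (int k) + (kcoeff i (n - i) (int (Suc k)) - kcoeff 1 (n - 1) (int (Suc k)))"
      using kcoeff_Suc_right[of i "n - i" "int k + 1"] kcoeff_Suc_right[of 1 "n - 1" "int k + 1"]
      by (simp add: Suc_diff_le ac_simps)
    then show "(\<Sum>j=1..n. (kcoeff i (n - i) (int j) - kcoeff 1 (n - 1) (int j)) * ?x j)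
        \<le> kcoeff 0 (n - 1) (int r) - kcoeff (i - 1) (n - i) (int r)"
      using i assms(4)[of i] by (subst sum_eq) (auto simp: kcoeff_gt)
  qed (use assms in auto)
  have objective: "lp_objective n \<alpha> ?x
      = t * kcoeff 0 n (int k) * (2 * (1 / \<alpha> - 1) - 1 / \<alpha> * ((real n + 1) / (real k + 1)))"
  proof -
    define s where "s = 1 / \<alpha>"
    define z where "z = kcoeff 0 n (int k)"
    have z: "kcoeff 0 n (int (Suc k)) = (real n - real k) * z / (real k + 1)"
      using kcoeff_absorb[of "int k" n] by (simp add: field_simps z_def)
    have "lp_objective n \<alpha> ?x = t * (((2 * real k / real n - 1) * (s - 1) - 1) * z
        + ((2 * (real k + 1) / real n - 1) * (s - 1) - 1) * ((real n - real k) * z / (real k + 1)))"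
      using assms(1,2)
      by (subst lp_objective_eq_kcoeff) (simp, subst sum_eq, auto simp: z[simplified] s_def z_def kcoeff_gt ac_simps)
    also have "\<dots> = t * z * (2 * (s - 1) - s * ((real n + 1) / (real k + 1)))"
    proof -
      have "real n > 0" "real k + 1 > 0" using assms by auto
      then have "((2 * real k / real n - 1) * (s - 1) - 1)
        + ((2 * (real k + 1) / real n - 1) * (s - 1) - 1) * ((real n - real k) / (real k + 1))
        = 2 * (s - 1) - s * ((real n + 1) / (real k + 1))"
        by (simp add: divide_simps) (simp add: algebra_simps)
      moreover have "t * (A * z + B * (C * z / D)) = t * z * (A + B * (C / D))" for A B C D
        by (simp add: algebra_simps)
      ultimately show ?thesis by metis
    qed
    finally show ?thesis by (simp add: s_def z_def)
  qed
  show ?thesis using Lambda_bar_ge_objective[OF feasible, of \<alpha>] unfolding objective .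
qed

section \<open>Small radius: r at most n/2 - 1\<close>

text \<open>Supplies the index conditions of \<open>abs_kcoeff_le_2\<close>. With h = n/2 + 2,
  \<open>tau n\<close> is (h - sqrt h) / 2.\<close>

lemma tau_range:
  assumes "n \<ge> 4" "real n - tau n \<le> real k" "u = int n - int k"
  shows "3 * u + 1 \<le> int n" "u \<le> 1 \<or> 2 * u + 4 < int n"
proof -
  define h where "h = real n / 2 + 2"
  define s where "s = sqrt h"
  have h: "h \<ge> 4" using assms by (simp add: h_def)
  have s2: "s * s = h" using h by (simp add: s_def)
  have s: "s \<ge> 2" using h by (auto simp: s_def intro: real_le_rsqrt)
  have u: "2 * real_of_int u \<le> h - s"
    using assms(2) by (simp add: assms(3) tau_def h_def s_def field_simps)
  have n: "real n = 2 * h - 4" by (simp add: h_def)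
  have "3 * real_of_int u + 1 \<le> real n" using u n h s by linarith
  then show "3 * u + 1 \<le> int n" by linarith
  show "u \<le> 1 \<or> 2 * u + 4 < int n"
  proof (rule ccontr)
    assume "\<not> ?thesis"
    then have "u \<ge> 2" "2 * real_of_int u + 4 \<ge> real n" by linarith+
    \<comment> \<open>With s \<ge> 2 these bounds force h = 6 and s = 2, against s^2 = h.\<close>
    then have "h \<ge> 6" "h + s \<le> 8" using u n s by linarith+
    moreover have "s \<noteq> 2" using s2 \<open>h \<ge> 6\<close> by auto
    ultimately show False using s by linarith
  qed
qed

lemma gchoose_eq_kcoeff: "n \<ge> 2 \<Longrightarrow> ((real n - 2) gchoose s) = kcoeff 0 (n - 2) (int s)"
  by (simp add: kcoeff_0_int binomial_gbinomial of_nat_diff)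

text \<open>Over these i the left-hand side is largest and the right-hand side smallest at i = 2,
  and the equation for \<open>t\<close> is equality there. The length \<open>N\<close> is n for one
  variable and n + 1 for a pair.\<close>

lemma tight_constraint:
  assumes r: "2 * r + 2 \<le> n" and i: "2 \<le> i" "i \<le> n - 1" "i \<le> N - 2" and N: "4 \<le> N"
    and u: "u = int N - int k" "3 * u + 1 \<le> int N" "u \<le> 1 \<or> 2 * u + 4 < int N"
    and t: "t \<ge> 0" "t * - kcoeff 1 (N - 2) (int k - 1) = kcoeff 0 (n - 2) (int r - 1)"
  shows "t * (kcoeff i (N - i) (int k) - kcoeff 1 (N - 1) (int k))
    \<le> kcoeff 0 (n - 1) (int r) - kcoeff (i - 1) (n - i) (int r)"
proof -
  have refl: "kcoeff a b (int k) = (-1) ^ a * kcoeff a b u" if "a + b = N" for a b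
  proof -
    have "int k = int a + int b - u" using u(1) that by linarith
    then show ?thesis by (simp only: kcoeff_reflect)
  qed
  have "\<bar>kcoeff i (N - i) (int k)\<bar> = \<bar>kcoeff i (N - i) u\<bar>"
    using refl[of i "N - i"] i N by (simp add: abs_mult power_abs)
  also have "\<dots> \<le> kcoeff 2 (N - 2) u"
    using abs_kcoeff_le_2[of i "N - i" u] i N u by simp
  also have "\<dots> = kcoeff 2 (N - 2) (int k)"
    using refl[of 2 "N - 2"] N by simp
  finally have le2: "kcoeff i (N - i) (int k) \<le> kcoeff 2 (N - 2) (int k)" by (simp add: abs_le_iff)
  have "kcoeff 2 (N - 2) (int k) - kcoeff 1 (N - 1) (int k) = 2 * - kcoeff 1 (N - 2) (int k - 1)"
  proof -
    have "N - 1 = Suc (N - 2)" using N by simp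
    then show ?thesis
      using kcoeff_Suc_left[of 1 "N - 2" "int k"] kcoeff_Suc_right[of 1 "N - 2" "int k"]
      by (simp add: numeral_2_eq_2)
  qed
  then have "t * (kcoeff 2 (N - 2) (int k) - kcoeff 1 (N - 1) (int k)) = 2 * kcoeff 0 (n - 2) (int r - 1)"
    using t(2) by (simp only: mult.left_commute[of t 2])
  moreover have "t * (kcoeff i (N - i) (int k) - kcoeff 1 (N - 1) (int k))
      \<le> t * (kcoeff 2 (N - 2) (int k) - kcoeff 1 (N - 1) (int k))"
    using le2 t(1) by (intro mult_left_mono) auto
  moreover have "2 * kcoeff 0 (n - 2) (int r - 1) = kcoeff 0 (n - 1) (int r) - kcoeff 1 (n - 2) (int r)"
  proof -
    have "n - 1 = Suc (n - 2)" using i by simp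
    then show ?thesis by (simp add: kcoeff_Suc_left kcoeff_Suc_right)
  qed
  \<comment> \<open>The first extremal inequality in length n - 1, where r lies below the
    middle.\<close>
  moreover have "\<bar>kcoeff (i - 1) (n - i) (int r)\<bar> \<le> kcoeff 1 (n - 2) (int r)"
  proof -
    have "i - 1 + (n - i) - 1 = n - 2" "int (i - 1) + int (n - i) = int n - 1" using i by auto
    then show ?thesis using abs_kcoeff_le[of "i - 1" "n - i" "int r"] i r by simp
  qed
  ultimately show ?thesis by (simp add: abs_le_iff)
qed

text \<open>The pair at k and k + 1 is governed by length n + 1, so \<open>tight_constraint\<close>
  covers every i < n. At i = n the left-hand side is 0 by \<open>kcoeff_swap\<close>, because k + 1
  is even.\<close>

lemma Lambda_bar_ge_even_low:
  assumes r: "even r" "1 \<le> r" "2 * r + 2 \<le> n" and k: "odd k" "k \<le> n" "real n - tau n \<le> real k"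
  shows "ereal (real n * ((real n - 2) gchoose (r - 1)) / (2 * real k - real n)
           * (2 * (1 / \<alpha> - 1) - 1 / \<alpha> * ((real n + 1) / (real k + 1)))) \<le> Lambda_bar n \<alpha> r"
proof -
  have n: "n \<ge> 4" using r by simp
  define c where "c = kcoeff 0 (n - 2) (int r - 1)"
  define z where "z = kcoeff 0 n (int k)"
  \<comment> \<open>This solves \<open>t * - kcoeff 1 (n - 1) (int k) = c\<close>, which is equality
    at i = 2.\<close>
  define t where "t = real n * c / ((2 * real k - real n) * z)"
  note u = tau_range[OF n k(3) refl]
  have "n < 2 * k" using u(1) n by presburger
  then have d: "2 * real k - real n > 0" by linarith
  have z: "z > 0" using k by (simp add: z_def kcoeff_0_pos)
  have t0: "t \<ge> 0" using d z by (simp add: t_def c_def kcoeff_0_nonneg)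
  have k1: "kcoeff 1 (n - 1) (int k) = - (2 * real k - real n) * z / real n"
    using kcoeff_1[of "n - 1" "int k"] n by (simp add: z_def of_nat_diff field_simps)
  have tk1: "t * - kcoeff 1 (n - 1) (int k) = c"
    unfolding k1 t_def using d z n by (simp add: field_simps)
  have "ereal (t * z * (2 * (1 / \<alpha> - 1) - 1 / \<alpha> * ((real n + 1) / (real k + 1)))) \<le> Lambda_bar n \<alpha> r"
    unfolding z_def
  proof (rule Lambda_bar_ge_pair)
    fix i assume i: "2 \<le> i" "i \<le> n"
    show "t * (kcoeff i (Suc n - i) (int k + 1) - kcoeff 1 n (int k + 1))
      \<le> kcoeff 0 (n - 1) (int r) - kcoeff (i - 1) (n - i) (int r)"
    proof (cases "i = n")
      case True
      have "kcoeff n 1 (int k + 1) = kcoeff 1 n (int k + 1)"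
        using kcoeff_swap[of n 1 "int k + 1"] k by simp
      then have L: "kcoeff i (Suc n - i) (int k + 1) - kcoeff 1 n (int k + 1) = 0"
        using True by simp
      have "kcoeff (n - 1) 0 (int r) \<le> kcoeff 0 (n - 1) (int r)"
        using abs_kcoeff_le_kcoeff_0[of "n - 1" 0 "int r"] by (simp add: abs_le_iff)
      then show ?thesis unfolding L using True by simp
    next
      case False
      have "t * (kcoeff i (Suc n - i) (int (Suc k)) - kcoeff 1 (Suc n - 1) (int (Suc k)))
          \<le> kcoeff 0 (n - 1) (int r) - kcoeff (i - 1) (n - i) (int r)"
      proof (rule tight_constraint)
        show "int n - int k = int (Suc n) - int (Suc k)" by simp
        show "3 * (int n - int k) + 1 \<le> int (Suc n)" using u(1) by simp
        show "int n - int k \<le> 1 \<or> 2 * (int n - int k) + 4 < int (Suc n)" using u(2) by auto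
        show "t * - kcoeff 1 (Suc n - 2) (int (Suc k) - 1) = kcoeff 0 (n - 2) (int r - 1)"
          using tk1 by (simp add: c_def numeral_2_eq_2)
      qed (use False r i n k t0 in auto)
      then show ?thesis by (simp add: add.commute)
    qed
  qed (use k t0 in \<open>auto intro: Suc_leI odd_pos\<close>)
  moreover have "t * z = real n * c / (2 * real k - real n)" using z by (simp add: t_def)
  moreover have "((real n - 2) gchoose (r - 1)) = c"
    using gchoose_eq_kcoeff[of n "r - 1"] n r by (simp add: c_def of_nat_diff)
  ultimately show ?thesis by simp
qed

text \<open>The claim amounts to 2 (K - A) (K - B) \<ge> B. The square root in \<open>F_set\<close>
  makes both factors at least sqrt C, and C \<ge> B/2. The resulting inequality is what the
  constraint i = n - 1 requires for odd k.\<close>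

lemma F_set_odd_bound:
  assumes "odd k" "k \<in> F_set n r" "r + 1 < n"
  shows "(2 * of_int k - real n) * real r * (real n - 1)
    \<le> of_int k * (2 * of_int k - real n - 1) * (real n - 1 - real r)"
proof -
  define q where "q = real n - 1 - real r"
  define \<rho> where "\<rho> = real r / q"
  define A where "A = (real n + 1) / 2"
  define B where "B = (real n - 1) * real r / q"
  define C where "C = (real n + 1) * real r / (2 * q)"
  define K :: real where "K = of_int k"
  have q: "q > 0" using assms by (simp add: q_def)
  have \<rho>: "\<rho> \<ge> 0" using q by (simp add: \<rho>_def)
  have K: "K \<ge> max A B + sqrt C"
    using assms unfolding F_set_def K_def A_def B_def C_def q_def by simp
  have B_eq: "B = (real n - 1) * \<rho>" and C_eq: "C = (real n + 1) * \<rho> / 2"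
    by (simp_all add: B_def C_def \<rho>_def)
  from K have "K - A \<ge> sqrt C" "K - B \<ge> sqrt C" by auto
  moreover have C: "C \<ge> 0" using \<rho> by (simp add: C_eq)
  moreover from C have "sqrt C \<ge> 0" by simp
  ultimately have "sqrt C * sqrt C \<le> (K - A) * (K - B)"
    by (intro mult_mono) linarith+
  then have "C \<le> (K - A) * (K - B)" using C by simp
  moreover have "B / 2 \<le> C" using \<rho> by (simp add: B_eq C_eq mult_right_mono)
  moreover have "K * (2 * K - real n - 1) - B * (2 * K - real n) = 2 * ((K - A) * (K - B)) - B"
    by (simp add: A_def field_simps)
  ultimately have "B * (2 * K - real n) \<le> K * (2 * K - real n - 1)" by linarith
  then have "q * (B * (2 * K - real n)) \<le> q * (K * (2 * K - real n - 1))"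
    using q by simp
  moreover have "q * B = (real n - 1) * real r" using q by (simp add: B_def)
  then have "q * (B * (2 * K - real n)) = (2 * K - real n) * real r * (real n - 1)"
    by (simp only: mult.assoc[symmetric]) (simp add: ac_simps)
  ultimately have "(2 * K - real n) * real r * (real n - 1) \<le> K * (2 * K - real n - 1) * q"
    by (simp only: mult.commute[of q])
  then show ?thesis unfolding K_def q_def .
qed

text \<open>A single variable at k, with \<open>tight_constraint\<close> for i \<le> n - 2. For even
  k the left-hand side vanishes at i = n - 1 and the constraint i = n remains; for odd k it is
  nonpositive at i = n and i = n - 1 remains. The two halves of \<open>F_set\<close> answer these
  two cases.\<close>

lemma Lambda_bar_ge_odd_low:
  assumes r: "odd r" "2 * r + 2 \<le> n" and k: "k \<le> n" "real n - tau n \<le> real k" "int k \<in> F_set n r"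
  shows "ereal ((real n - 1) * ((real n - 2) gchoose (r - 1)) / (2 * real k - real n - 1)
           * (2 * (1 / \<alpha> - 1) - 1 / \<alpha> * (real n / real k))) \<le> Lambda_bar n \<alpha> r"
proof -
  have r1: "r \<ge> 1" using r by (cases r) auto
  then have n: "n \<ge> 4" using r by simp
  define c where "c = kcoeff 0 (n - 2) (int r - 1)"
  define y where "y = kcoeff 0 (n - 1) (int k - 1)"
  define w where "w = kcoeff 0 (n - 1) (int r)"
  define d where "d = 2 * real k - real n - 1"
  define t where "t = (real n - 1) * c / (d * y)"
  note u = tau_range[OF n k(2) refl]
  have "n + 1 < 2 * k" using u(1) n by presburger
  then have d: "d > 0" unfolding d_def by linarith
  have k1: "k \<ge> 1" using u(1) n by presburger
  have y: "y > 0" using k k1 n by (simp add: y_def kcoeff_0_pos of_nat_diff)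
  have t0: "t \<ge> 0" using d y n by (simp add: t_def c_def kcoeff_0_nonneg)
  have w0: "w \<ge> 0" by (simp add: w_def kcoeff_0_nonneg)
  have n1: "n - 1 = Suc (n - 2)" and n0: "n = Suc (n - 1)" using n by auto
  have tk1: "t * - kcoeff 1 (n - 2) (int k - 1) = c"
  proof -
    have k1_eq: "kcoeff 1 (n - 2) (int k - 1) = - d * y / (real n - 1)"
      using kcoeff_1[of "n - 2" "int k - 1"] n n1
      by (simp add: y_def d_def of_nat_diff field_simps)
    show ?thesis unfolding k1_eq t_def using d y n by (simp add: field_simps)
  qed
  have rw: "(real n - 1) * c = real r * w"
    using kcoeff_absorb_Suc[of "int r" "n - 2"] n n1 by (simp add: c_def w_def of_nat_diff)
  have tyd: "t * y * d = real r * w" unfolding rw[symmetric] t_def using d y by simp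
  have nk: "kcoeff 0 n (int k) = kcoeff 0 (n - 1) (int k) + y"
    "kcoeff 1 (n - 1) (int k) = kcoeff 0 (n - 1) (int k) - y"
    using kcoeff_Suc_right[of 0 "n - 1" "int k"] n0 by (simp_all add: y_def kcoeff_Suc_left)
  have ky: "real k * kcoeff 0 n (int k) = real n * y"
    using kcoeff_absorb_Suc[of "int k" "n - 1"] n n0 by (simp add: y_def of_nat_diff)
  have "ereal (t * kcoeff 0 n (int k) * real k / real n * (2 * (1 / \<alpha> - 1) - 1 / \<alpha> * (real n / real k)))
      \<le> Lambda_bar n \<alpha> r"
  proof (rule Lambda_bar_ge_single)
    fix i assume i: "2 \<le> i" "i \<le> n"
    consider "i = n" | "i = n - 1" | "i \<le> n - 2" using i by linarith
    then show "t * (kcoeff i (n - i) (int k) - kcoeff 1 (n - 1) (int k))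
        \<le> kcoeff 0 (n - 1) (int r) - kcoeff (i - 1) (n - i) (int r)"
    proof cases
      case 1
      have R: "kcoeff 0 (n - 1) (int r) - kcoeff (i - 1) (n - i) (int r) = 2 * w"
        using 1 kcoeff_swap[of "n - 1" 0 "int r"] r by (simp add: w_def)
      have L: "kcoeff i (n - i) (int k) = (if even k then 1 else -1) * kcoeff 0 n (int k)"
        using 1 kcoeff_swap[of n 0 "int k"] by simp
      show ?thesis
      proof (cases "even k")
        case True
        \<comment> \<open>The constraint reads t y \<le> w; since t y d = r w, it follows from r
          \<le> d, that is k \<ge> (n + r + 1) / 2.\<close>
        then have "real r \<le> d" using k(3) by (simp add: F_set_def d_def)
        then have "t * y * d \<le> d * w" unfolding tyd using w0 by (rule mult_right_mono)
        then have "t * y \<le> w" using d by (simp add: mult.commute[of d])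
        then show ?thesis unfolding R L nk using True by (simp add: algebra_simps)
      next
        case False
        have "kcoeff i (n - i) (int k) - kcoeff 1 (n - 1) (int k) = - 2 * kcoeff 0 (n - 1) (int k)"
          unfolding L nk using False by simp
        also have "\<dots> \<le> 0" by (simp add: kcoeff_0_nonneg)
        finally have "t * (kcoeff i (n - i) (int k) - kcoeff 1 (n - 1) (int k)) \<le> 0"
          using t0 by (intro mult_nonneg_nonpos)
        then show ?thesis unfolding R using w0 by linarith
      qed
    next
      case 2
      define v where "v = kcoeff 0 (n - 2) (int r)"
      have ni: "n - i = 1" "i - 1 = n - 2" using 2 n by auto
      have R: "kcoeff 0 (n - 1) (int r) - kcoeff (i - 1) (n - i) (int r) = 2 * v"
        unfolding ni using kcoeff_swap[of "n - 2" 1 "int r"] r n1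
        by (simp add: v_def kcoeff_Suc_left kcoeff_Suc_right)
      have L: "kcoeff i (n - i) (int k) = (if even k then 1 else -1) * kcoeff 1 (n - 1) (int k)"
        unfolding ni unfolding 2 using kcoeff_swap[of "n - 1" 1 "int k"] by simp
      have v0: "v \<ge> 0" by (simp add: v_def kcoeff_0_nonneg)
      show ?thesis
      proof (cases "even k")
        case True
        then show ?thesis unfolding R L using v0 by simp
      next
        case False
        \<comment> \<open>The constraint reads
          \<open>t * - kcoeff 1 (n - 1) (int k) \<le> v\<close>; multiplied by k d (n - 1) it
          becomes this inequality times \<open>w\<close>.\<close>
        have F: "(2 * real k - real n) * real r * (real n - 1) \<le> real k * d * (real n - 1 - real r)"
          using F_set_odd_bound[of "int k" n r] False k r n by (simp add: d_def)
        have v: "(real n - 1 - real r) * w = (real n - 1) * v"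
          using kcoeff_absorb_Suc'[of "n - 2" "int r"] n n1 by (simp add: v_def w_def of_nat_diff)
        have K1: "real k * - kcoeff 1 (n - 1) (int k) = (2 * real k - real n) * y"
        proof -
          have "real n * kcoeff 1 (n - 1) (int k) = (real n - 2 * real k) * kcoeff 0 n (int k)"
            using kcoeff_1[of "n - 1" "int k"] n n0 by (simp add: of_nat_diff)
          then have "real n * (real k * kcoeff 1 (n - 1) (int k)) = (real n - 2 * real k) * (real k * kcoeff 0 n (int k))"
            by (simp add: mult.left_commute)
          then have "real n * (real k * kcoeff 1 (n - 1) (int k)) = real n * ((real n - 2 * real k) * y)"
            unfolding ky by (simp only: mult.left_commute)
          then have "real k * kcoeff 1 (n - 1) (int k) = (real n - 2 * real k) * y"
            using n by (simp only: mult_cancel_left) simp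
          then show ?thesis by (simp add: algebra_simps)
        qed
        have "(real k * d * (real n - 1)) * (t * - kcoeff 1 (n - 1) (int k))
            = (t * d * (real n - 1)) * (real k * - kcoeff 1 (n - 1) (int k))"
          by (simp add: ac_simps)
        also have "\<dots> = (t * y * d) * ((2 * real k - real n) * (real n - 1))"
          unfolding K1 by (simp add: ac_simps)
        also have "\<dots> = ((2 * real k - real n) * real r * (real n - 1)) * w"
          unfolding tyd by (simp add: ac_simps)
        also have "\<dots> \<le> (real k * d * (real n - 1 - real r)) * w"
          using F w0 by (rule mult_right_mono)
        also have "\<dots> = (real k * d * (real n - 1)) * v"
          using v by (simp add: ac_simps)
        finally have "t * - kcoeff 1 (n - 1) (int k) \<le> v"
          by (rule mult_left_le_imp_le) (use k1 d n in simp)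
        moreover have "t * (kcoeff i (n - i) (int k) - kcoeff 1 (n - 1) (int k))
            = 2 * (t * - kcoeff 1 (n - 1) (int k))"
          unfolding L using False by simp
        ultimately show ?thesis unfolding R by linarith
      qed
    next
      case 3
      show ?thesis
        by (rule tight_constraint[OF _ _ _ _ _ refl u])
          (use 3 r i n k t0 tk1 in \<open>auto simp: c_def\<close>)
    qed
  qed (use k k1 t0 in auto)
  moreover have "t * kcoeff 0 n (int k) * real k / real n = (real n - 1) * c / (2 * real k - real n - 1)"
  proof -
    have "t * kcoeff 0 n (int k) * real k / real n = t * (real k * kcoeff 0 n (int k)) / real n"
      by (simp add: ac_simps)
    also have "\<dots> = t * y" unfolding ky using n by simp
    also have "\<dots> = (real n - 1) * c / d" using y by (simp add: t_def)
    finally show ?thesis by (simp add: d_def)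
  qed
  moreover have "((real n - 2) gchoose (r - 1)) = c"
    using gchoose_eq_kcoeff[of n "r - 1"] n r1 by (simp add: c_def of_nat_diff)
  ultimately show ?thesis by simp
qed

section \<open>Large radius: r above n/2 - 1\<close>

lemma kcoeff_0_central: "kcoeff 0 (2 * r - 1) (int r - 1) = kcoeff 0 (2 * r - 1) (int r)" if "1 \<le> r"
  using kcoeff_reflect[of 0 "2 * r - 1" "int r"] that by (simp add: of_nat_diff algebra_simps)

text \<open>Serves even r. For n \<le> 2 r the index r is above the middle of length n - 1 and the
  first extremal inequality applies; for n = 2 r + 1 it is the middle, and the central bound takes
  over.\<close>

lemma twice_kcoeff_Suc_le_diff:
  assumes r: "1 \<le> r" "n \<le> 2 * r + 1" and i: "2 \<le> i" "i \<le> n - 1"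
  shows "2 * kcoeff 0 (n - 2) (int r + 1) \<le> kcoeff 0 (n - 1) (int r) - kcoeff (i - 1) (n - i) (int r)"
proof -
  define c where "c v = kcoeff 0 (n - 2) v" for v
  define K where "K = kcoeff (i - 1) (n - i) (int r)"
  have n1: "n - 1 = Suc (n - 2)" using i by simp
  have w: "kcoeff 0 (n - 1) (int r) = c (int r) + c (int r - 1)"
    by (simp only: n1 kcoeff_Suc_right c_def)
  have idx: "i - 1 + (n - i) - 1 = n - 2" "int (i - 1) + int (n - i) = int n - 1"
    "i - 1 + (n - i) = n - 1" "real (i - 1) + real (n - i) = real n - 1" using i by auto
  have c0: "c v \<ge> 0" for v by (simp add: c_def kcoeff_0_nonneg)
  have ratio: "(real r + 1) * c (int r + 1) = (real n - 2 - real r) * c (int r)"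
    using kcoeff_absorb[of "int r" "n - 2"] i by (simp add: c_def of_nat_diff)
  show ?thesis
  proof (cases "n = 2 * r + 1")
    case True
    have cr: "c (int r - 1) = c (int r)"
      using kcoeff_0_central[of r] True r by (simp add: c_def)
    \<comment> \<open>The drop from r to r + 1; the goal becomes
      \<open>\<bar>K\<bar> \<le> 2 * D\<close>.\<close>
    define D where "D = c (int r) - c (int r + 1)"
    have D: "(real r + 1) * D = 2 * c (int r)"
      using ratio True by (simp add: D_def algebra_simps)
    have "(real r + 1) * D \<ge> 0" using D c0[of "int r"] by simp
    then have "D \<ge> 0" by (simp add: zero_le_mult_iff)
    have "(2 * real r - 1) * \<bar>K\<bar> \<le> 2 * c (int r)"
      using abs_kcoeff_middle_le[of "i - 1" "n - i" "int r"] i True idx w cr by (simp add: K_def)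
    also have "\<dots> = (real r + 1) * D" using D by simp
    also have "\<dots> \<le> (2 * (2 * real r - 1)) * D"
      using \<open>D \<ge> 0\<close> r by (intro mult_right_mono) auto
    finally have "(2 * real r - 1) * \<bar>K\<bar> \<le> (2 * real r - 1) * (2 * D)" by (simp add: ac_simps)
    then have "\<bar>K\<bar> \<le> 2 * D" using r by simp
    then show ?thesis unfolding w K_def[symmetric] using cr by (simp add: D_def c_def abs_le_iff)
  next
    case False
    have "\<bar>K\<bar> \<le> c (int r - 1) - c (int r)"
      using abs_kcoeff_le_upper[of "i - 1" "n - i" "int r"] i r False idx
      by (simp add: K_def c_def kcoeff_Suc_left)
    moreover have "(real r + 1) * c (int r + 1) \<le> (real r + 1) * c (int r)"
      unfolding ratio using r c0 by (intro mult_right_mono) auto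
    then have "c (int r + 1) \<le> c (int r)" by simp
    ultimately show ?thesis unfolding w K_def[symmetric] by (simp add: c_def abs_le_iff)
  qed
qed

text \<open>Serves odd r with n \<le> 2 r: above the middle of length n - 1 the subtracted term is
  at most the drop from r - 1 to r of the binomial coefficients of length n - 2.\<close>

lemma twice_kcoeff_le_diff:
  assumes r: "n \<le> 2 * r" and i: "2 \<le> i" "i \<le> n - 1"
  shows "2 * kcoeff 0 (n - 2) (int r) \<le> kcoeff 0 (n - 1) (int r) - kcoeff (i - 1) (n - i) (int r)"
proof -
  have n1: "n - 1 = Suc (n - 2)" using i by simp
  have "kcoeff 0 (n - 1) (int r) = kcoeff 0 (n - 2) (int r) + kcoeff 0 (n - 2) (int r - 1)"
    by (simp only: n1 kcoeff_Suc_right)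
  moreover have idx: "i - 1 + (n - i) - 1 = n - 2" "int (i - 1) + int (n - i) = int n - 1" using i by auto
  have "\<bar>kcoeff (i - 1) (n - i) (int r)\<bar> \<le> kcoeff 0 (n - 2) (int r - 1) - kcoeff 0 (n - 2) (int r)"
    using abs_kcoeff_le_upper[of "i - 1" "n - i" "int r"] i r idx by (simp add: kcoeff_Suc_left)
  ultimately show ?thesis by (simp add: abs_le_iff)
qed

text \<open>For even i the term \<open>K\<close> is a central coefficient with an odd exponent of 1
  - x, hence 0. For odd i it costs at most 2 c / (n - 2), and the gain from
  \<open>abs_kcoeff_le_strict\<close> on the left pays exactly that.\<close>

lemma central_constraint:
  assumes r: "odd r" "n = 2 * r + 1" and i: "2 \<le> i" "i \<le> n - 1"
    and k: "odd k" "k \<le> n" "n + 2 \<le> 2 * k"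
    and t: "t \<ge> 0" "t * - kcoeff 1 (n - 1) (int k) = kcoeff 0 (n - 2) (int r)"
  shows "t * (kcoeff i (n - i) (int k) - kcoeff 1 (n - 1) (int k))
    \<le> kcoeff 0 (n - 1) (int r) - kcoeff (i - 1) (n - i) (int r)"
proof -
  define c where "c = kcoeff 0 (n - 2) (int r)"
  define K where "K = kcoeff (i - 1) (n - i) (int r)"
  have r1: "r \<ge> 1" using r by (cases r) auto
  have n1: "n - 1 = Suc (n - 2)" using i by simp
  have idx: "i - 1 + (n - i) = n - 1" "int (i - 1) + int (n - i) = 2 * int r"
    "real (i - 1) + real (n - i) = 2 * real r" using i r by auto
  have w: "kcoeff 0 (n - 1) (int r) = 2 * c"
  proof -
    have "kcoeff 0 (n - 1) (int r) = kcoeff 0 (n - 2) (int r) + kcoeff 0 (n - 2) (int r - 1)"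
      by (simp only: n1 kcoeff_Suc_right)
    then show ?thesis using kcoeff_0_central[OF r1] r(2) by (simp add: c_def)
  qed
  have c0: "c \<ge> 0" by (simp add: c_def kcoeff_0_nonneg)
  have Kb: "(2 * real r - 1) * \<bar>K\<bar> \<le> 2 * c"
  proof -
    have "1 \<le> i - 1" "1 \<le> n - i" using i by auto
    from abs_kcoeff_middle_le[OF this, of "int r"] show ?thesis
      unfolding idx w K_def by simp
  qed
  have tc: "t * kcoeff 1 (n - 1) (int k) = - c" using t(2) by (simp add: c_def)
  show ?thesis
  proof (cases "even i")
    case True
    have "odd (i - 1)" using True i by auto
    then have "K = 0"
      using kcoeff_reflect[of "i - 1" "n - i" "int r"] idx by (simp add: K_def)
    moreover have "kcoeff i (n - i) (int k) \<le> - kcoeff 1 (n - 1) (int k)"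
      using abs_kcoeff_le_upper[of i "n - i" "int k"] i k by (simp add: abs_le_iff of_nat_diff)
    then have "t * kcoeff i (n - i) (int k) \<le> t * - kcoeff 1 (n - 1) (int k)"
      using t(1) by (rule mult_left_mono)
    ultimately show ?thesis
      unfolding w K_def[symmetric] using tc by (simp add: algebra_simps)
  next
    case False
    define u where "u = int n - int k"
    define k1 where "k1 = kcoeff 1 (n - 1) u"
    have refl: "kcoeff a b (int k) = - kcoeff a b u" if "odd a" "a + b = n" for a b
    proof -
      have "int k = int a + int b - u" using that by (simp add: u_def)
      then show ?thesis using that by (simp only: kcoeff_reflect) simp
    qed
    have K1: "kcoeff 1 (n - 1) (int k) = - k1" using refl[of 1 "n - 1"] i by (simp add: k1_def)
    have Ki: "kcoeff i (n - i) (int k) = - kcoeff i (n - i) u" using refl[of i "n - i"] i False by simp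
    have tk1: "t * k1 = c" using tc unfolding K1 by simp
    \<comment> \<open>The strict bound needs n - i \<ge> 2; i is odd while n - 1 = 2 r is
      even.\<close>
    have i2: "i \<noteq> n - 1" using False r by auto
    have K_le: "\<bar>K\<bar> \<le> 2 * c"
    proof -
      have "1 * \<bar>K\<bar> \<le> (2 * real r - 1) * \<bar>K\<bar>" using r1 by (intro mult_right_mono) auto
      then show ?thesis using Kb by simp
    qed
    show ?thesis
    \<comment> \<open>For k = n both coefficients on the left are -1 and cancel.\<close>
    proof (cases "u = 0")
      case True
      then show ?thesis
        unfolding w K_def[symmetric] K1 Ki using K_le by (simp add: k1_def kcoeff_at_0 abs_le_iff)
    next
      case u: False
      have "odd n" using r by simp
      then have "2 * k \<noteq> n + 2" by presburger
      then have u2: "1 \<le> u" "2 * u < int n - 2" using u k by (auto simp: u_def)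
      have "(real n - 2) * - kcoeff i (n - i) u \<le> (real n - 2) * \<bar>kcoeff i (n - i) u\<bar>"
        using i by (intro mult_left_mono) auto
      also have "\<dots> \<le> (real n - 4) * k1"
        using abs_kcoeff_le_strict[of i "n - i" u] i i2 u2 by (simp add: of_nat_diff k1_def)
      finally have "t * ((real n - 2) * - kcoeff i (n - i) u) \<le> t * ((real n - 4) * k1)"
        using t(1) by (rule mult_left_mono)
      also have "\<dots> = (real n - 4) * c" using tk1 by (simp add: ac_simps)
      finally have "(2 * real r - 1) * (t * (kcoeff i (n - i) (int k) - kcoeff 1 (n - 1) (int k)))
          \<le> (2 * real r - 3) * c + (2 * real r - 1) * c"
        unfolding K1 Ki using tk1 r(2) by (simp add: algebra_simps)
      also have "\<dots> \<le> (2 * real r - 1) * (2 * c - \<bar>K\<bar>)" using Kb by (simp add: algebra_simps)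
      also have "\<dots> \<le> (2 * real r - 1) * (2 * c - K)" using r1 by (intro mult_left_mono) auto
      finally show ?thesis unfolding w K_def[symmetric] using r1 by simp
    qed
  qed
qed

text \<open>The choice of \<open>t\<close> and the first extremal inequality keep the left-hand side
  below 2 c for i < n. The index \<open>s\<close> is chosen so that the slack can absorb this, with
  the case n = 2 r + 1, r odd, treated jointly by \<open>central_constraint\<close>.\<close>

lemma Lambda_bar_ge_high:
  assumes r: "1 \<le> r" "n < 2 * r + 2" and k: "odd k" "k \<le> n" "n + 2 \<le> 2 * k"
    and s: "s = (if even r then r + 1 else r)"
  shows "ereal (real k * ((real n - 2) gchoose s) / (2 * real k - real n)
           * (2 * (1 / \<alpha> - 1) - 1 / \<alpha> * (real n / real k))) \<le> Lambda_bar n \<alpha> r"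
proof -
  \<comment> \<open>For n = 2 the range would leave only k = 2, which is even.\<close>
  have n: "n \<ge> 3" using k by (cases "n = 2") auto
  define c where "c = kcoeff 0 (n - 2) (int s)"
  define z where "z = kcoeff 0 n (int k)"
  define t where "t = real n * c / ((2 * real k - real n) * z)"
  have d: "2 * real k - real n > 0" using k by linarith
  have z: "z > 0" using k by (simp add: z_def kcoeff_0_pos)
  have t0: "t \<ge> 0" using d z by (simp add: t_def c_def kcoeff_0_nonneg)
  have k1: "kcoeff 1 (n - 1) (int k) = - (2 * real k - real n) * z / real n"
    using kcoeff_1[of "n - 1" "int k"] n by (simp add: z_def of_nat_diff field_simps)
  have tk1: "t * - kcoeff 1 (n - 1) (int k) = c"
    unfolding k1 t_def using d z n by (simp add: field_simps)
  have "ereal (t * z * real k / real n * (2 * (1 / \<alpha> - 1) - 1 / \<alpha> * (real n / real k))) \<le> Lambda_bar n \<alpha> r"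
    unfolding z_def
  proof (rule Lambda_bar_ge_single)
    fix i assume i: "2 \<le> i" "i \<le> n"
    show "t * (kcoeff i (n - i) (int k) - kcoeff 1 (n - 1) (int k))
        \<le> kcoeff 0 (n - 1) (int r) - kcoeff (i - 1) (n - i) (int r)"
    proof (cases "i = n")
      case True
      \<comment> \<open>For odd k the value K_k(n) is the least possible, so the left-hand side is
        nonpositive.\<close>
      have "kcoeff n 0 (int k) = - kcoeff 0 n (int k)" using kcoeff_swap[of n 0 "int k"] k by simp
      also have "\<dots> \<le> kcoeff 1 (n - 1) (int k)"
        using abs_kcoeff_le_kcoeff_0[of 1 "n - 1" "int k"] n by (simp add: abs_le_iff)
      finally have "t * (kcoeff i (n - i) (int k) - kcoeff 1 (n - 1) (int k)) \<le> 0"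
        using True t0 by (simp add: mult_nonneg_nonpos)
      moreover have "kcoeff (n - 1) 0 (int r) \<le> kcoeff 0 (n - 1) (int r)"
        using abs_kcoeff_le_kcoeff_0[of "n - 1" 0 "int r"] by (simp add: abs_le_iff)
      ultimately show ?thesis using True by simp
    next
      case False
      then have i': "i \<le> n - 1" using i by simp
      have "kcoeff i (n - i) (int k) \<le> - kcoeff 1 (n - 1) (int k)"
        using abs_kcoeff_le_upper[of i "n - i" "int k"] i i' k by (simp add: abs_le_iff of_nat_diff)
      then have "t * kcoeff i (n - i) (int k) \<le> t * - kcoeff 1 (n - 1) (int k)"
        using t0 by (rule mult_left_mono)
      then have le: "t * (kcoeff i (n - i) (int k) - kcoeff 1 (n - 1) (int k)) \<le> 2 * c"
        using tk1 by (simp add: algebra_simps)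
      consider "even r" | "odd r" "n = 2 * r + 1" | "odd r" "n \<le> 2 * r" using r by linarith
      then show ?thesis
      proof cases
        case 1
        then show ?thesis
          using twice_kcoeff_Suc_le_diff[of r n i] r i i' s le by (simp add: c_def add.commute)
      next
        case 2
        then show ?thesis
          using central_constraint[of r n i k t] i i' k t0 tk1 s by (simp add: c_def)
      next
        case 3
        then show ?thesis
          using twice_kcoeff_le_diff[of n r i] r i i' s le by (simp add: c_def)
      qed
    qed
  qed (use k t0 in \<open>auto intro: Suc_leI odd_pos\<close>)
  moreover have "t * z * real k / real n = real k * c / (2 * real k - real n)"
    using z n d by (simp add: t_def field_simps)
  moreover have "((real n - 2) gchoose s) = c"
    using gchoose_eq_kcoeff[of n s] n by (simp add: c_def)
  ultimately show ?thesis by simp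
qed

section \<open>Termwise comparison with \<open>psi\<close>\<close>

text \<open>Keeps the integer indices from n - tau(n) on nonnegative, so that they are natural
  numbers.\<close>

lemma tau_le: "n \<ge> 1 \<Longrightarrow> tau n \<le> real n"
proof -
  assume "n \<ge> 1"
  then have "real n \<ge> 1" by simp
  moreover have "sqrt (real n / 2 + 2) \<ge> 1" by simp
  ultimately show ?thesis unfolding tau_def by argo
qed

theorem theorem12:
  fixes n r M :: nat and \<alpha> :: real
  assumes "n \<ge> 1"
    and "r \<in> {1..n}"
    and "M \<in> {1..2 ^ n}"
    and "\<alpha> = real M / 2 ^ n"
  shows "Lambda_bar n \<alpha> r \<ge> psi_plus n \<alpha> r"
proof -
  have r: "1 \<le> r" using assms by simp
  have range: "\<exists>k'. k = int k' \<and> k' \<le> n \<and> a \<le> real k'" if "k \<in> int_range a (real n)" "a \<ge> 0" for k a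
    using that by (intro exI[of _ "nat k"]) (auto simp: int_range_def)
  \<comment> \<open>A bound on each term suffices, since a supremum over an empty index set is
    -\<infinity>.\<close>
  have "psi n \<alpha> r \<le> Lambda_bar n \<alpha> r"
  proof (cases "real r \<le> real n / 2 - 1")
    case low: True
    then have r2: "2 * r + 2 \<le> n" by linarith
    have nonneg: "real n - tau n \<ge> 0" using tau_le[OF assms(1)] by simp
    show ?thesis
    proof (cases "even r")
      case True
      have "ereal (real n * ((real n - 2) gchoose (r - 1)) / (2 * of_int k - real n)
          * (2 * (1 / \<alpha> - 1) - 1 / \<alpha> * ((real n + 1) / (of_int k + 1)))) \<le> Lambda_bar n \<alpha> r"
        if "k \<in> int_range (real n - tau n) (real n)" "odd k" for k
        using range[OF that(1) nonneg] Lambda_bar_ge_even_low[OF True r r2] that(2) by auto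
      then show ?thesis
        unfolding psi_def using low True by (auto intro!: SUP_least)
    next
      case False
      have "ereal ((real n - 1) * ((real n - 2) gchoose (r - 1)) / (2 * of_int k - real n - 1)
          * (2 * (1 / \<alpha> - 1) - 1 / \<alpha> * (real n / of_int k))) \<le> Lambda_bar n \<alpha> r"
        if "k \<in> int_range (real n - tau n) (real n)" "k \<in> F_set n r" for k
        using range[OF that(1) nonneg] Lambda_bar_ge_odd_low[OF False r2] that(2) by auto
      then show ?thesis
        unfolding psi_def using low False by (auto intro!: SUP_least)
    qed
  next
    case high: False
    then have r2: "n < 2 * r + 2" by linarith
    have "ereal (of_int k * ((real n - 2) gchoose (if even r then r + 1 else r)) / (2 * of_int k - real n)
        * (2 * (1 / \<alpha> - 1) - 1 / \<alpha> * (real n / of_int k))) \<le> Lambda_bar n \<alpha> r"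
      if k: "k \<in> int_range (real n / 2 + 1) (real n)" "odd k" for k
    proof -
      obtain k' where k': "k = int k'" "k' \<le> n" "real n / 2 + 1 \<le> real k'"
        using range[OF k(1)] by auto
      then have "n + 2 \<le> 2 * k'" by linarith
      then show ?thesis using Lambda_bar_ge_high[OF r r2 _ k'(2) _ refl] k(2) k'(1) by simp
    qed
    then show ?thesis
      unfolding psi_def using high by (auto intro!: SUP_least)
  qed
  then show ?thesis
    unfolding psi_plus_def using Lambda_bar_nonneg[of n \<alpha> r] by simp
qed

end
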